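(* For any $w\in C\cap\overline{B}_\beta$, the Fréchet normal cone is $$\widehat N(w,C\cap\overline{B}_\beta)=\Big\{y\in\mathbb{R}^d:\forall i\in I(w)\cup J(w),\ \forall j\in[d_i],\ y^i_j\in\begin{cases}\mathbb{R}_{\ge0}&\text{if }w^i_j=\beta\\ \{0\}&\text{if }|w^i_j|<\beta\\ \mathbb{R}_{\le0}&\text{if }w^i_j=-\beta\end{cases}\Big\}.$$
   Context: $[n]:=\{1,\dots,n\}$. For $n\le d$, the coordinates of a vector in $\mathbb{R}^d$ are partitioned into blocks $w^1,\dots,w^n$, with $w^i\in\mathbb{R}^{d_i}$ and $\sum_{i=1}^nd_i=d$. Let $m>0$ and $0<p_i\le m$ for $i\in[n]$. Let $C:=\{w\in\mathbb{R}^d:\sum_{i=1}^np_i\mathbb{1}_{\{w^i\ne0\}}(w)\le m\}$, where $\{w^i\neq0\}$ is the set of $w$ whose $i$-th block is not the zero vector. $\beta>0$ and $\overline{B}_\beta:=\{z\in\mathbb{R}^d:|z_i|\le\beta,\ i=1,\dots,d\}$. For $w\in C\cap\overline{B}_\beta$: $I(w):=\{i\in[n]:w^i\ne0\}$ and $J(w):=\{j\in[n]\setminus I(w):\sum_{i\in I(w)}p_i+p_j\le m\}$. For a set $A$ and $w\in A$, the Fréchet normal cone is $\widehat N(w,A):=\{y\in\mathbb{R}^d:\limsup_{x\to w,\,x\in A}\frac{\langle y,x-w\rangle}{\|x-w\|_2}\le0\}$. *)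

theory Defs
  imports "HOL-Analysis.Analysis"
begin

text \<open>
  The partition of the coordinates into blocks is given by a surjective map \<open>b\<close> sending each
  coordinate to the index of its block: the pairs \<open>(i, j)\<close> with \<open>j \<in> [d\<^sub>i]\<close> are the coordinates
  \<open>k\<close> with \<open>b k = i\<close>, and surjectivity says \<open>d\<^sub>i \<ge> 1\<close> for every \<open>i\<close>.
\<close>

text \<open>The \<open>i\<close>-th block of \<open>w\<close>, extended by zero to the whole space.\<close>

definition block :: "('d \<Rightarrow> 'n) \<Rightarrow> 'n \<Rightarrow> real ^ 'd \<Rightarrow> real ^ 'd::finite" where
  "block b i w = (\<chi> k. if b k = i then w $ k else 0)"

definition sparse_set :: "('d \<Rightarrow> 'n) \<Rightarrow> ('n \<Rightarrow> real) \<Rightarrow> real \<Rightarrow> (real ^ 'd::finite) set" where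
  "sparse_set b p m = {w. (\<Sum>i\<in>UNIV. p i * indicat_real {v. block b i v \<noteq> 0} w) \<le> m}"

definition box_ball :: "real \<Rightarrow> (real ^ 'd::finite) set" where
  "box_ball \<beta> = {z. \<forall>k. \<bar>z $ k\<bar> \<le> \<beta>}"

definition active :: "('d \<Rightarrow> 'n) \<Rightarrow> real ^ 'd::finite \<Rightarrow> 'n set" where
  "active b w = {i. block b i w \<noteq> 0}"

definition addable :: "('d \<Rightarrow> 'n) \<Rightarrow> ('n \<Rightarrow> real) \<Rightarrow> real \<Rightarrow> real ^ 'd::finite \<Rightarrow> 'n set" where
  "addable b p m w = {j. j \<notin> active b w \<and> (\<Sum>i\<in>active b w. p i) + p j \<le> m}"

text \<open>
  The upper limit is taken in the extended reals, over \<open>x \<in> A\<close> with \<open>x \<noteq> w\<close>; at an isolated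
  point of \<open>A\<close> it is \<open>-\<infinity>\<close>, so that the cone is the whole space there.
\<close>

definition frechet_normal_cone :: "'a::real_inner \<Rightarrow> 'a set \<Rightarrow> 'a set" where
  "frechet_normal_cone w A =
     {y. Limsup (at w within A) (\<lambda>x. ereal ((y \<bullet> (x - w)) / norm (x - w))) \<le> 0}"

end

theory Submission imports Defs begin

text \<open>
  Close to \<open>w\<close>, a point \<open>x\<close> of the constraint set keeps the active blocks of \<open>w\<close> active, and each
  further active block of \<open>x\<close> must fit into the remaining budget. Hence \<open>x - w\<close> lives on the
  active and addable blocks, where the constraint set is locally just the box; conversely every
  coordinate direction in these blocks that points into the box is feasible.
\<close>

text \<open>The quotient is constant along a ray from \<open>w\<close>, so a ray that stays in
  \<open>A\<close> for small \<open>t > 0\<close> passes the bound on the upper limit directly to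
  its direction \<open>v\<close>.\<close>

lemma frechet_normal_coneD:
  assumes y: "y \<in> frechet_normal_cone w A"
    and v: "eventually (\<lambda>t. w + t *\<^sub>R v \<in> A) (at_right 0)"
  shows "y \<bullet> v \<le> 0"
proof (rule ccontr)
  assume pos: "\<not> y \<bullet> v \<le> 0"
  then have "v \<noteq> 0" by auto
  \<comment> \<open>\<open>c\<close> is the value of the quotient at every point
    \<open>w + t *\<^sub>R v\<close> with \<open>t > 0\<close>, since the factor \<open>t\<close>
    cancels.\<close>
  define c where "c = (y \<bullet> v) / norm v"
  have "c > 0" using pos \<open>v \<noteq> 0\<close> by (simp add: c_def)
  then have "Limsup (at w within A) (\<lambda>x. ereal ((y \<bullet> (x - w)) / norm (x - w))) < ereal c"
    using y by (auto simp: frechet_normal_cone_def zero_ereal_def intro: le_less_trans)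
  then have ev: "eventually (\<lambda>x. (y \<bullet> (x - w)) / norm (x - w) < c) (at w within A)"
    by (auto dest: Limsup_lessD)
  have "filterlim (\<lambda>t. w + t *\<^sub>R v) (at w within A) (at_right 0)"
  proof (rule filterlim_at[THEN iffD2, OF conjI])
    show "eventually (\<lambda>t. w + t *\<^sub>R v \<in> A \<and> w + t *\<^sub>R v \<noteq> w) (at_right 0)"
      using v eventually_at_right_less[of 0] by eventually_elim (use \<open>v \<noteq> 0\<close> in auto)
    have "((\<lambda>t. w + t *\<^sub>R v) \<longlongrightarrow> w + 0 *\<^sub>R v) (at_right 0)"
      by (intro tendsto_intros)
    then show "((\<lambda>t. w + t *\<^sub>R v) \<longlongrightarrow> w) (at_right 0)" by simp
  qed
  \<comment> \<open>Pulled back along the ray, the bound in \<open>ev\<close> reads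
    \<open>c < c\<close>, while \<open>at_right 0\<close> is a nontrivial filter.\<close>
  from eventually_compose_filterlim[OF ev this] eventually_at_right_less[of 0]
  have "eventually (\<lambda>t::real. False) (at_right 0)"
    by eventually_elim (simp add: c_def)
  then show False by simp
qed

text \<open>In general the cone only asks for the inequality up to an error of order
  o(\<open>norm (x - w)\<close>). The constraint set is a union of polyhedral pieces, so here the
  exact inequality holds near \<open>w\<close>.\<close>

lemma frechet_normal_coneI:
  assumes "eventually (\<lambda>x. y \<bullet> (x - w) \<le> 0) (at w within A)"
  shows "y \<in> frechet_normal_cone w A"
proof -
  have "Limsup (at w within A) (\<lambda>x. ereal ((y \<bullet> (x - w)) / norm (x - w))) \<le> 0"
    using assms by (intro Limsup_bounded) (auto elim!: eventually_mono simp: divide_nonpos_nonneg)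
  then show ?thesis by (simp add: frechet_normal_cone_def)
qed

lemma active_iff: "i \<in> active b w \<longleftrightarrow> (\<exists>k. b k = i \<and> w $ k \<noteq> 0)"
  by (auto simp: active_def block_def vec_eq_iff)

lemma sparse_set_iff:
  fixes b :: "'d::finite \<Rightarrow> 'n::finite"
  shows "w \<in> sparse_set b p m \<longleftrightarrow> (\<Sum>i\<in>active b w. p i) \<le> m"
proof -
  have "(\<Sum>i\<in>UNIV. p i * indicat_real {v. block b i v \<noteq> 0} w) = (\<Sum>i\<in>active b w. p i)"
    by (rule sum.mono_neutral_cong_right) (auto simp: active_def)
  then show ?thesis by (simp add: sparse_set_def)
qed

text \<open>Changing coordinate \<open>k\<close> can activate no block but \<open>b k\<close>, whose
  weight is either already counted or still affordable. The change may also switch that block off,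
  hence an inclusion and nonnegative weights.\<close>

lemma sparse_set_add_axis:
  fixes b :: "'d::finite \<Rightarrow> 'n::finite"
  assumes "\<And>i. 0 \<le> p i" "w \<in> sparse_set b p m" "b k \<in> active b w \<union> addable b p m w"
  shows "w + axis k s \<in> sparse_set b p m"
proof -
  have "active b (w + axis k s) \<subseteq> insert (b k) (active b w)"
    by (auto simp: active_iff axis_def split: if_splits)
  then have "(\<Sum>i\<in>active b (w + axis k s). p i) \<le> (\<Sum>i\<in>insert (b k) (active b w). p i)"
    by (intro sum_mono2) (auto simp: assms(1))
  also have "\<dots> \<le> m"
    using assms(2,3)
    by (cases "b k \<in> active b w") (auto simp: sparse_set_iff addable_def insert_absorb add.commute)
  finally show ?thesis by (simp add: sparse_set_iff)
qed

text \<open>The bound towards which the coordinate moves is strict at \<open>w\<close> and survives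
  small steps by continuity; the opposite bound is preserved by the sign of
  \<open>s\<close>.\<close>

lemma eventually_box_ball_add_axis:
  assumes w: "w \<in> box_ball \<beta>"
    and s: "s > 0 \<Longrightarrow> w $ k < \<beta>" "s < 0 \<Longrightarrow> - \<beta> < w $ k"
  shows "eventually (\<lambda>t. w + t *\<^sub>R axis k s \<in> box_ball \<beta>) (at_right 0)"
proof -
  have w_le: "- \<beta> \<le> w $ j" "w $ j \<le> \<beta>" for j
    using w by (auto simp: box_ball_def abs_le_iff minus_le_iff)
  have lim: "((\<lambda>t. w $ k + t * s) \<longlongrightarrow> w $ k + 0 * s) (at_right 0)"
    by (intro tendsto_intros)
  have up: "eventually (\<lambda>t. w $ k + t * s \<le> \<beta>) (at_right 0)"
  proof (cases "s > 0")
    case True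
    with order_tendstoD(2)[OF lim, of \<beta>] s show ?thesis by (auto elim!: eventually_mono)
  next
    case False
    show ?thesis using eventually_at_right_less[of 0]
    proof eventually_elim
      case (elim t)
      then have "t * s \<le> 0" using False by (simp add: mult_nonneg_nonpos)
      then show ?case using w_le(2)[of k] by simp
    qed
  qed
  have lo: "eventually (\<lambda>t. - \<beta> \<le> w $ k + t * s) (at_right 0)"
  proof (cases "s < 0")
    case True
    with order_tendstoD(1)[OF lim, of "- \<beta>"] s show ?thesis by (auto elim!: eventually_mono)
  next
    case False
    show ?thesis using eventually_at_right_less[of 0]
    proof eventually_elim
      case (elim t)
      then have "0 \<le> t * s" using False by simp
      then show ?case using w_le(1)[of k] by simp
    qed
  qed
  from up lo show ?thesis
  proof eventually_elim
    case (elim t)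
    have "\<bar>(w + t *\<^sub>R axis k s) $ j\<bar> \<le> \<beta>" for j
      using elim w_le[of j] by (cases "j = k") (auto simp: axis_def abs_le_iff)
    then show ?case by (simp add: box_ball_def)
  qed
qed

text \<open>Finitely many nonzero coordinates stay nonzero near \<open>w\<close>, by
  continuity.\<close>

lemma eventually_active_subset:
  fixes b :: "'d::finite \<Rightarrow> 'n::finite"
  shows "eventually (\<lambda>x. active b w \<subseteq> active b x) (at w within A)"
proof -
  have "eventually (\<lambda>x. \<forall>k. w $ k \<noteq> 0 \<longrightarrow> x $ k \<noteq> 0) (at w within A)"
  proof (rule eventually_all_finite)
    fix k
    have "((\<lambda>x. x $ k) \<longlongrightarrow> w $ k) (at w within A)"
      by (intro tendsto_intros)
    then show "eventually (\<lambda>x. w $ k \<noteq> 0 \<longrightarrow> x $ k \<noteq> 0) (at w within A)"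
      by (cases "w $ k = 0") (auto dest: tendsto_imp_eventually_ne)
  qed
  then show ?thesis
    by eventually_elim (metis active_iff subsetI)
qed

text \<open>The budget of \<open>x\<close> pays for all active blocks of \<open>w\<close> together
  with any single new block \<open>i\<close>, which is exactly the condition for \<open>i\<close> to
  be addable. Several addable blocks need not fit jointly.\<close>

lemma active_subset_addable:
  fixes b :: "'d::finite \<Rightarrow> 'n::finite"
  assumes "\<And>i. 0 \<le> p i" "x \<in> sparse_set b p m" "active b w \<subseteq> active b x"
  shows "active b x \<subseteq> active b w \<union> addable b p m w"
proof
  fix i assume i: "i \<in> active b x"
  show "i \<in> active b w \<union> addable b p m w"
  proof (cases "i \<in> active b w")
    case False
    have "(\<Sum>j\<in>active b w. p j) + p i = (\<Sum>j\<in>insert i (active b w). p j)"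
      using False by simp
    also have "\<dots> \<le> (\<Sum>j\<in>active b x. p j)"
      using i assms(3) by (intro sum_mono2) (auto simp: assms(1))
    also have "\<dots> \<le> m" using assms(2) by (simp add: sparse_set_iff)
    finally show ?thesis using False by (simp add: addable_def)
  qed simp
qed

theorem proposition9:
  fixes b :: "'d::finite \<Rightarrow> 'n::finite"
    and p :: "'n \<Rightarrow> real" and m \<beta> :: real
    and w :: "real ^ 'd"
  assumes "surj b"
    and "m > 0"
    and "\<And>i. 0 < p i \<and> p i \<le> m"
    and "\<beta> > 0"
    and "w \<in> sparse_set b p m \<inter> box_ball \<beta>"
  shows "frechet_normal_cone w (sparse_set b p m \<inter> box_ball \<beta>) =
    {y. \<forall>i \<in> active b w \<union> addable b p m w. \<forall>k. b k = i \<longrightarrow>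
          (w $ k = \<beta> \<longrightarrow> y $ k \<ge> 0) \<and>
          (\<bar>w $ k\<bar> < \<beta> \<longrightarrow> y $ k = 0) \<and>
          (w $ k = -\<beta> \<longrightarrow> y $ k \<le> 0)}"
    (is "frechet_normal_cone w ?A = ?N")
proof (rule set_eqI, rule iffI)
  fix y
  have p: "0 \<le> p i" for i using assms(3)[of i] by simp
  {
    assume y: "y \<in> frechet_normal_cone w ?A"
    have dir: "y $ k * s \<le> 0"
      if "b k \<in> active b w \<union> addable b p m w" "s > 0 \<Longrightarrow> w $ k < \<beta>" "s < 0 \<Longrightarrow> - \<beta> < w $ k" for k s
    proof -
      have scale: "t *\<^sub>R axis k s = axis k (t * s)" for t
        by (simp add: axis_def vec_eq_iff)
      have "eventually (\<lambda>t. w + t *\<^sub>R axis k s \<in> box_ball \<beta>) (at_right 0)"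
        using assms that by (intro eventually_box_ball_add_axis) auto
      then have "eventually (\<lambda>t. w + t *\<^sub>R axis k s \<in> ?A) (at_right 0)"
        by eventually_elim (use assms(5) p that(1) in \<open>auto simp: scale intro: sparse_set_add_axis\<close>)
      from frechet_normal_coneD[OF y this] show ?thesis
        by (simp add: inner_axis)
    qed
    \<comment> \<open>The direction \<open>s = 1\<close> is admissible when
      \<open>w $ k < \<beta>\<close> and gives \<open>y $ k \<le> 0\<close>; \<open>s = -1\<close>
      is admissible when \<open>- \<beta> < w $ k\<close> and gives \<open>y $ k \<ge> 0\<close>.
      Since \<open>\<beta> > 0\<close>, the two faces are distinct, so on each of them the inward
      direction remains.\<close>
    have "(w $ k = \<beta> \<longrightarrow> y $ k \<ge> 0) \<and> (\<bar>w $ k\<bar> < \<beta> \<longrightarrow> y $ k = 0) \<and> (w $ k = -\<beta> \<longrightarrow> y $ k \<le> 0)"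
      if "b k \<in> active b w \<union> addable b p m w" for k
      using dir[OF that, of 1] dir[OF that, of "-1"] \<open>\<beta> > 0\<close>
      by (auto intro: antisym)
    then show "y \<in> ?N" by blast
  next
    assume y: "y \<in> ?N"
    have "eventually (\<lambda>x. x \<in> ?A) (at w within ?A)"
      by (simp add: eventually_at_filter)
    with eventually_active_subset[of b w ?A]
    have "eventually (\<lambda>x. y \<bullet> (x - w) \<le> 0) (at w within ?A)"
    proof eventually_elim
      case (elim x)
      have act: "active b x \<subseteq> active b w \<union> addable b p m w"
        using elim p by (intro active_subset_addable) auto
      \<comment> \<open>The inner product is bounded coordinate by coordinate: on active and addable
        blocks \<open>y $ k\<close> has the sign opposite to any move into the box, and elsewhere
        \<open>x\<close> and \<open>w\<close> both vanish, so \<open>y $ k\<close> may be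
        arbitrary.\<close>
      have "y $ k * (x $ k - w $ k) \<le> 0" for k
      proof (cases "b k \<in> active b w \<union> addable b p m w")
        case True
        then have yk: "w $ k = \<beta> \<Longrightarrow> y $ k \<ge> 0" "\<bar>w $ k\<bar> < \<beta> \<Longrightarrow> y $ k = 0"
          "w $ k = -\<beta> \<Longrightarrow> y $ k \<le> 0"
          using y by auto
        have xk: "\<bar>x $ k\<bar> \<le> \<beta>" and wk: "\<bar>w $ k\<bar> \<le> \<beta>"
          using elim(2) assms(5) by (auto simp: box_ball_def)
        consider "w $ k = \<beta>" | "\<bar>w $ k\<bar> < \<beta>" | "w $ k = -\<beta>" using wk by linarith
        then show ?thesis
          using yk xk by cases (auto simp: mult_le_0_iff)
      next
        case False
        then have "b k \<notin> active b x" "b k \<notin> active b w"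
          using act by auto
        then have "x $ k = 0" "w $ k = 0"
          by (auto simp: active_iff)
        then show ?thesis by simp
      qed
      then show ?case by (simp add: inner_vec_def sum_nonpos)
    qed
    then show "y \<in> frechet_normal_cone w ?A" by (rule frechet_normal_coneI)
  }
qed

end
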